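(* Let $(\mathrm{X},\mu)$ be a metric measure space of exact polynomial growth of degree $q>0$, let $X_0\subseteq X$ be a bounded set, and let $C:=\frac{3^{q+1}}{3^{q+1}-1}$. There exists $\varepsilon_0\in(0,1)$ such that for every $\varepsilon\in(0,\varepsilon_0)$ there exists a number $s_0=s_0(\varepsilon,X_0)$ such that for every tower $\mathcal{U}$ (over some nonempty subset of $X$) satisfying 1) $\mathcal{U}$ is $\left(1+\frac{36q}{\varepsilon}\right)$-expanding; 2) $\mathrm{core}(\mathcal{U})\subseteq X_0$; 3) $\mathrm{rad}(\mathcal{U})\geq s_0$; 4) $\mathrm{ht}(\mathcal{U})\geq1+\log_C\frac{2}{\varepsilon}$, there exists a disjoint subcollection $\mathcal{V}\subseteq\mathcal{U}$ such that $$\mu\left(\bigcup_{V\in\mathcal{V}}V\right)\geq(1-\varepsilon)\,\mu\left(\bigcup_{W\in\mathcal{U}_1}W\right).$$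
   Context: A metric measure space $(\mathrm{X},\mu)$ is a metric space $\mathrm{X}=(X,d)$ with a Borel measure $\mu$ on $X$. $\mathrm{B}(x,r)$ is the closed ball. The measure $\mu$ is strictly positive if $0<\mu(\mathrm{B}(x,r))<\infty$ for all $x\in X$, $r>0$. $(\mathrm{X},\mu)$ with $\mu$ strictly positive is of exact polynomial (volume) growth of degree $q\geq0$ if there is a constant $c_X>0$ with $\lim_{t\to\infty}\frac{\mu(\mathrm{B}(x,t))}{c_Xt^q}=1$ for all $x\in X$. Balls always come with a chosen center and radius. For a ball $W=\mathrm{B}(y,s)$ and $\delta\geq0$, $W^\delta:=\mathrm{B}(y,(1+\delta)s)$. For a collection $\mathcal{C}$ of balls, $\mathrm{rad}(\mathcal{C})$ is the infimum of the radii of its balls and $\mathrm{core}(\mathcal{C})$ is the set of centers of its balls. For a nonempty $W\subseteq X$ and $n\in\mathbb{N}$, a tower $\mathcal{U}$ over $W$ of height $\mathrm{ht}(\mathcal{U})=n$ is a finite collection of balls $\mathcal{U}=\{U_i(x):x\in W,\ i=1,\dots,n\}$ indexed by $x\in W$ and $i=1,\dots,n$ ($W$ may be infinite, but the collection of balls is finite) such that $x\in U_i(x)$ for all $x\in W$ and all $i$, and $U_1(x)\subseteq U_2(x)\subseteq\dots\subseteq U_n(x)$ for all $x\in W$. Its $i$-th level is $\mathcal{U}_i:=\{U_i(x):x\in W\}$. For $\delta\geq0$ the tower is $\delta$-expanding if $U_i(x)^\delta\subseteq U_{i+1}(x)$ for all $x\in W$, $i=1,\dots,n-1$. *)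

theory Defs
  imports "HOL-Analysis.Analysis"
begin

text \<open>The metric space X is a type of class \<open>metric_space\<close> (every nonempty metric space is of
  this form up to isometry); a Borel measure on it is a measure whose sigma-algebra is the Borel
  one. Closed balls are \<open>cball\<close>.\<close>

definition borel_measure :: "'a::metric_space measure \<Rightarrow> bool" where
  "borel_measure \<mu> \<longleftrightarrow> sets \<mu> = sets borel"

definition strictly_positive :: "'a::metric_space measure \<Rightarrow> bool" where
  "strictly_positive \<mu> \<longleftrightarrow>
     (\<forall>x. \<forall>r>0. 0 < emeasure \<mu> (cball x r) \<and> emeasure \<mu> (cball x r) < \<infinity>)"

text \<open>The real-valued \<open>measure\<close> is harmless in the limit: balls of positive radius have finite
  measure by strict positivity.\<close>

definition exact_polynomial_growth :: "'a::metric_space measure \<Rightarrow> real \<Rightarrow> bool" where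
  "exact_polynomial_growth \<mu> q \<longleftrightarrow> borel_measure \<mu> \<and> strictly_positive \<mu> \<and> q \<ge> 0 \<and>
     (\<exists>c>0. \<forall>x. ((\<lambda>t. measure \<mu> (cball x t) / (c * t powr q)) \<longlongrightarrow> 1) at_top)"

text \<open>A ball with its chosen center and radius. No sign condition is imposed on the radius; the
  balls of a tower are nonempty, hence have nonnegative radius.\<close>

type_synonym 'a marked_ball = "'a \<times> real"

abbreviation center :: "'a marked_ball \<Rightarrow> 'a" where "center \<equiv> fst"

abbreviation radius :: "'a marked_ball \<Rightarrow> real" where "radius \<equiv> snd"

definition pts :: "'a::metric_space marked_ball \<Rightarrow> 'a set" where
  "pts B = cball (center B) (radius B)"

definition enlarge :: "real \<Rightarrow> 'a marked_ball \<Rightarrow> 'a marked_ball" where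
  "enlarge \<delta> B = (center B, (1 + \<delta>) * radius B)"

definition rad :: "'a marked_ball set \<Rightarrow> real" where
  "rad \<C> = Inf (radius ` \<C>)"

definition core :: "'a marked_ball set \<Rightarrow> 'a set" where
  "core \<C> = center ` \<C>"

text \<open>A tower over \<open>W\<close> of height \<open>n\<close> is given by the assignment \<open>U\<close>, where \<open>U i x\<close> is the ball
  $U_i(x)$; only the values with \<open>x \<in> W\<close> and \<open>1 \<le> i \<le> n\<close> matter. The collection of balls is a
  set of marked balls, so repeated balls are identified.\<close>

definition tower_level :: "'a set \<Rightarrow> (nat \<Rightarrow> 'a \<Rightarrow> 'a marked_ball) \<Rightarrow> nat \<Rightarrow> 'a marked_ball set" where
  "tower_level W U i = U i ` W"

definition tower_balls :: "'a set \<Rightarrow> nat \<Rightarrow> (nat \<Rightarrow> 'a \<Rightarrow> 'a marked_ball) \<Rightarrow> 'a marked_ball set" where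
  "tower_balls W n U = (\<Union>i\<in>{1..n}. tower_level W U i)"

definition tower ::
  "'a::metric_space set \<Rightarrow> nat \<Rightarrow> (nat \<Rightarrow> 'a \<Rightarrow> 'a marked_ball) \<Rightarrow> bool" where
  "tower W n U \<longleftrightarrow> W \<noteq> {} \<and> finite (tower_balls W n U) \<and>
     (\<forall>x\<in>W. \<forall>i\<in>{1..n}. x \<in> pts (U i x)) \<and>
     (\<forall>x\<in>W. \<forall>i\<in>{1..<n}. pts (U i x) \<subseteq> pts (U (Suc i) x))"

definition expanding ::
  "real \<Rightarrow> 'a::metric_space set \<Rightarrow> nat \<Rightarrow> (nat \<Rightarrow> 'a \<Rightarrow> 'a marked_ball) \<Rightarrow> bool" where
  "expanding \<delta> W n U \<longleftrightarrow>
     (\<forall>x\<in>W. \<forall>i\<in>{1..<n}. pts (enlarge \<delta> (U i x)) \<subseteq> pts (U (Suc i) x))"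

end

theory Submission
  imports Defs
begin

text \<open>Select balls greedily, from the top level of the tower downwards. On each level, discard the
  points whose ball already meets a selected ball, and apply the Vitali covering lemma to those of
  the remaining balls that are maximal under inclusion. If \<open>U\<^sub>i(x)\<close> meets a ball \<open>B\<close> selected on level
  \<open>i + 1\<close>, then either \<open>U\<^sub>i(x)\<close> is much smaller than \<open>B\<close>, hence contained in a slight enlargement of
  \<open>B\<close>, or \<open>U\<^sub>i\<^sub>+\<^sub>1(x)\<close> contains \<open>B\<close> because the tower is expanding, and then equals \<open>B\<close> by maximality.
  So the discarded part is covered by slight enlargements of the selected balls, whose total measure
  is at most \<open>1 + \<epsilon>/2\<close> times that of the balls themselves, while by the Vitali lemma every level
  captures at least the proportion \<open>3 powr -(q + 1)\<close> of what is left.\<close>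

section \<open>Vitali covering for finite families of balls\<close>

text \<open>A ball of largest radius is selected and every ball meeting it is dropped: a dropped
  ball has no larger radius, so its points lie within three times the selected radius of the
  selected center. Induction treats the rest. As \<open>enlarge \<gamma>\<close> multiplies radii by
  \<open>1 + \<gamma>\<close>, \<open>enlarge 2\<close> is the usual factor 3.\<close>

lemma Vitali_finite:
  fixes F :: "'a::metric_space marked_ball set"
  assumes "finite F" and "\<And>B. B \<in> F \<Longrightarrow> radius B \<ge> 0"
  shows "\<exists>V\<subseteq>F. disjoint_family_on pts V \<and>
    (\<Union>B\<in>F. pts B) \<subseteq> (\<Union>B\<in>V. pts (enlarge 2 B))"
  using assms
proof (induction F rule: finite_psubset_induct)
  case (psubset F)
  show ?case
  proof (cases "F = {}")
    case True
    then show ?thesis by (auto simp: disjoint_family_on_def)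
  next
    case False
    then obtain B where B: "B \<in> F" "\<And>D. D \<in> F \<Longrightarrow> radius D \<le> radius B"
      using \<open>finite F\<close> obtains_MAX[of F radius] by (metis Max_ge finite_imageI imageI)
    define G where "G = {D \<in> F. pts D \<inter> pts B = {}}"
    \<comment> \<open>Nonnegativity of the radius makes \<open>B\<close> meet itself, so
      \<open>G\<close> loses \<open>B\<close> and the induction hypothesis applies to it.\<close>
    have Bne: "center B \<in> pts B"
      using psubset.prems B(1) by (auto simp: pts_def)
    then have "G \<subset> F"
      using B(1) by (auto simp: G_def)
    then obtain V where V: "V \<subseteq> G" "disjoint_family_on pts V"
        "(\<Union>B\<in>G. pts B) \<subseteq> (\<Union>B\<in>V. pts (enlarge 2 B))"
      using psubset.IH[of G] psubset.prems by blast
    have "pts D \<subseteq> pts (enlarge 2 B)" if D: "D \<in> F" "D \<notin> G" for D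
    proof
      fix y assume y: "y \<in> pts D"
      obtain z where z: "z \<in> pts D" "z \<in> pts B"
        using D by (auto simp: G_def)
      have "dist (center B) y \<le> dist (center B) z + dist z (center D) + dist (center D) y"
        by metric
      also have "\<dots> \<le> 3 * radius B"
        using y z B(2)[OF D(1)] by (auto simp: pts_def dist_commute)
      finally show "y \<in> pts (enlarge 2 B)"
        by (simp add: pts_def enlarge_def)
    qed
    then have "(\<Union>B\<in>F. pts B) \<subseteq> (\<Union>B\<in>insert B V. pts (enlarge 2 B))"
      using V(3) by blast
    moreover have "disjoint_family_on pts (insert B V)"
      using V(1,2) by (fastforce simp: disjoint_family_on_def G_def)
    moreover have "insert B V \<subseteq> F"
      using V(1) B(1) by (auto simp: G_def)
    ultimately show ?thesis by blast
  qed
qed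

text \<open>By finiteness every ball lies in one that is maximal under inclusion, so covering the
  maximal balls suffices. Maximality is phrased through \<open>pts\<close> because different marked
  balls can have the same points.\<close>

lemma Vitali_finite_maximal:
  fixes F :: "'a::metric_space marked_ball set"
  assumes "finite F" and "\<And>B. B \<in> F \<Longrightarrow> radius B \<ge> 0"
  shows "\<exists>V\<subseteq>F. disjoint_family_on pts V \<and>
    (\<Union>B\<in>F. pts B) \<subseteq> (\<Union>B\<in>V. pts (enlarge 2 B)) \<and>
    (\<forall>B\<in>V. \<forall>D\<in>F. pts B \<subseteq> pts D \<longrightarrow> pts D = pts B)"
proof -
  define G where "G = {B \<in> F. \<forall>D\<in>F. pts B \<subseteq> pts D \<longrightarrow> pts D = pts B}"
  have "\<exists>D\<in>G. pts B \<subseteq> pts D" if B: "B \<in> F" for B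
  proof -
    obtain D where D: "D \<in> F" "pts B \<subseteq> pts D" "\<forall>E\<in>F. pts D \<subseteq> pts E \<longrightarrow> pts D = pts E"
      using finite_has_maximal2[OF finite_imageI[OF assms(1)] imageI[OF B], of pts] by auto
    then have "D \<in> G" unfolding G_def by blast
    then show ?thesis using D(2) by blast
  qed
  then have "(\<Union>B\<in>F. pts B) \<subseteq> (\<Union>B\<in>G. pts B)"
    by blast
  moreover have "G \<subseteq> F" unfolding G_def by blast
  moreover have "finite G" using finite_subset[OF \<open>G \<subseteq> F\<close> assms(1)] .
  then obtain V where "V \<subseteq> G" "disjoint_family_on pts V"
      "(\<Union>B\<in>G. pts B) \<subseteq> (\<Union>B\<in>V. pts (enlarge 2 B))"
    using Vitali_finite[of G] assms(2) \<open>G \<subseteq> F\<close> by blast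
  moreover have "\<forall>B\<in>V. \<forall>D\<in>F. pts B \<subseteq> pts D \<longrightarrow> pts D = pts B"
    using \<open>V \<subseteq> G\<close> unfolding G_def by blast
  ultimately show ?thesis
    by (meson order_trans)
qed

section \<open>Selecting disjoint balls from an expanding tower\<close>

text \<open>If the balls meet and a point of \<open>B\<close> escapes
  \<open>enlarge \<delta> D\<close>, the triangle inequality gives
  \<open>\<delta> * radius D \<le> 2 * radius B\<close>. So \<open>D\<close> stays within
  \<open>radius B + 2 * radius D \<le> (1 + 4 / \<delta>) * radius B\<close> of the center of
  \<open>B\<close>.\<close>

lemma pts_subset_enlarge:
  assumes "pts D \<inter> pts B \<noteq> {}" and "0 < \<delta>"
    and "\<not> pts B \<subseteq> pts (enlarge \<delta> D)"
  shows "pts D \<subseteq> pts (enlarge (4 / \<delta>) B)"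
proof -
  obtain z where z: "z \<in> pts D" "z \<in> pts B" using assms(1) by blast
  obtain w where w: "w \<in> pts B" "w \<notin> pts (enlarge \<delta> D)" using assms(3) by blast
  have "dist (center D) w \<le> dist (center D) z + dist z (center B) + dist (center B) w"
    by metric
  then have "\<delta> * radius D \<le> 2 * radius B"
    using z w by (auto simp: pts_def enlarge_def dist_commute algebra_simps)
  then have small: "radius D \<le> 2 * radius B / \<delta>"
    using assms(2) by (simp add: field_simps)
  show ?thesis
  proof
    fix y assume y: "y \<in> pts D"
    have "dist (center B) y \<le> dist (center B) z + dist z (center D) + dist (center D) y"
      by metric
    also have "\<dots> \<le> radius B + 2 * radius D"
      using y z by (auto simp: pts_def dist_commute)
    also have "\<dots> \<le> (1 + 4 / \<delta>) * radius B"
      using small by (simp add: distrib_right)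
    finally show "y \<in> pts (enlarge (4 / \<delta>) B)"
      by (simp add: pts_def enlarge_def)
  qed
qed

lemma measure_UN_enlarge_le:
  assumes "finite V" and "disjoint_family_on pts V"
    and "\<And>B. B \<in> V \<Longrightarrow> pts B \<in> fmeasurable \<mu>"
    and "\<And>B. B \<in> V \<Longrightarrow> pts (enlarge \<gamma> B) \<in> fmeasurable \<mu>"
    and "\<And>B. B \<in> V \<Longrightarrow> measure \<mu> (pts (enlarge \<gamma> B)) \<le> M * measure \<mu> (pts B)"
  shows "measure \<mu> (\<Union>B\<in>V. pts (enlarge \<gamma> B)) \<le> M * measure \<mu> (\<Union>B\<in>V. pts B)"
proof -
  have "measure \<mu> (\<Union>B\<in>V. pts (enlarge \<gamma> B)) \<le> (\<Sum>B\<in>V. measure \<mu> (pts (enlarge \<gamma> B)))"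
    using assms(1,4) by (intro measure_UNION_le) auto
  also have "\<dots> \<le> (\<Sum>B\<in>V. M * measure \<mu> (pts B))"
    using assms(5) by (intro sum_mono)
  also have "\<dots> = M * measure \<mu> (\<Union>B\<in>V. pts B)"
    using assms(1-3)
    by (subst measure_finite_Union) (auto simp: sum_distrib_left dest: fmeasurableD fmeasurableD2)
  finally show ?thesis .
qed

text \<open>Volume growth enters only through \<open>L\<close>, for tripled balls, and
  \<open>M\<close>, for slightly enlarged ones. The quantity tracked is the deficit, the measure of
  \<open>A\<close> minus \<open>M\<close> times that of the selected balls: after each treated level
  it is at most \<open>1 - 1 / L\<close> times its former value.\<close>

lemma tower_selection:
  fixes \<mu> :: "'a::metric_space measure" and L M \<delta> :: real
  assumes tower: "tower W n U" and expanding: "expanding \<delta> W n U" and "0 < \<delta>"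
    and fin: "\<And>x r. cball x r \<in> fmeasurable \<mu>"
    and L: "\<And>B. B \<in> tower_balls W n U \<Longrightarrow> measure \<mu> (pts (enlarge 2 B)) \<le> L * measure \<mu> (pts B)"
    and M: "\<And>B. B \<in> tower_balls W n U \<Longrightarrow>
      measure \<mu> (pts (enlarge (4 / \<delta>) B)) \<le> M * measure \<mu> (pts B)"
    and "1 \<le> L" "1 \<le> M" "1 \<le> n"
  defines "A \<equiv> \<Union>B\<in>tower_level W U 1. pts B"
  shows "\<exists>V\<subseteq>tower_balls W n U. disjoint_family_on pts V \<and>
    measure \<mu> A - M * measure \<mu> (\<Union>B\<in>V. pts B) \<le> (1 - 1 / L) ^ (n - 1) * measure \<mu> A"
proof -
  let ?T = "tower_balls W n U" and ?v = "\<lambda>V. measure \<mu> (\<Union>B\<in>V. pts B)"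
  have finT: "finite ?T" using tower by (simp add: tower_def)
  have inT: "U i x \<in> ?T" if "x \<in> W" "1 \<le> i" "i \<le> n" for i x
    using that by (auto simp: tower_balls_def tower_level_def)
  have mem: "x \<in> pts (U i x)" if "x \<in> W" "1 \<le> i" "i \<le> n" for i x
    using tower that by (auto simp: tower_def)
  have step_sub: "pts (U i x) \<subseteq> pts (U (Suc i) x)" if "x \<in> W" "1 \<le> i" "i < n" for i x
    using tower that by (auto simp: tower_def)
  have bottom: "pts (U 1 x) \<subseteq> pts (U i x)" if "x \<in> W" "1 \<le> i" "i \<le> n" for i x
    using that(2,3)
  proof (induction i rule: dec_induct)
    case (step i)
    then show ?case using step_sub[OF that(1), of i] by simp
  qed simp
  have radius_nonneg: "0 \<le> radius (U i x)" if "x \<in> W" "1 \<le> i" "i \<le> n" for i x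
    using mem[OF that] by (auto simp: pts_def intro: order_trans[OF zero_le_dist])
  have fm: "pts B \<in> fmeasurable \<mu>" for B
    by (simp add: pts_def fin)
  have fmU: "(\<Union>B\<in>V. pts B) \<in> fmeasurable \<mu>" if "V \<subseteq> ?T" for V
    using finite_subset[OF that finT] fm by (intro fmeasurable.finite_UN) auto
  \<comment> \<open>Invariant after treating \<open>k\<close> levels from the top: \<open>W'\<close>
    consists of points whose ball on the next level \<open>n - k\<close> misses the selection
    \<open>V\<close>, and the first-level balls of all other points are already covered. As
    \<open>k < n\<close>, balls are selected only from levels 2 to \<open>n\<close>, whence the
    exponent \<open>n - 1\<close>.\<close>
  have claim: "\<exists>V\<subseteq>?T. \<exists>W'\<subseteq>W. disjoint_family_on pts V \<and>
      (\<forall>x\<in>W'. \<forall>B\<in>V. pts (U (n - k) x) \<inter> pts B = {}) \<and>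
      (\<forall>x\<in>W - W'. \<exists>B\<in>V. pts (U 1 x) \<subseteq> pts (enlarge (4 / \<delta>) B)) \<and>
      measure \<mu> A - M * ?v V \<le> (1 - 1 / L) ^ k * measure \<mu> A" if "k < n" for k
    using that
  proof (induction k)
    case 0
    show ?case
      by (intro exI[of _ "{}"] conjI exI[of _ W]) (auto simp: disjoint_family_on_def)
  next
    case (Suc k)
    define i where "i = n - Suc k"
    have i: "1 \<le> i" "i < n" "n - k = Suc i"
      using Suc.prems by (auto simp: i_def)
    obtain V W' where V: "V \<subseteq> ?T" "disjoint_family_on pts V" and W': "W' \<subseteq> W"
      and disj: "\<And>x B. x \<in> W' \<Longrightarrow> B \<in> V \<Longrightarrow> pts (U (Suc i) x) \<inter> pts B = {}"
      and cov: "\<And>x. x \<in> W - W' \<Longrightarrow> \<exists>B\<in>V. pts (U 1 x) \<subseteq> pts (enlarge (4 / \<delta>) B)"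
      and le: "measure \<mu> A - M * ?v V \<le> (1 - 1 / L) ^ k * measure \<mu> A"
      using Suc.IH Suc.prems unfolding i(3) by (metis Suc_lessD)
    let ?F = "U (Suc i) ` W'"
    have FT: "?F \<subseteq> ?T" using inT W' i by auto
    have radius_F: "radius B \<ge> 0" if "B \<in> ?F" for B
      using that radius_nonneg W' i by auto
    then obtain V' where V': "V' \<subseteq> ?F" "disjoint_family_on pts V'"
        "(\<Union>B\<in>?F. pts B) \<subseteq> (\<Union>B\<in>V'. pts (enlarge 2 B))"
      and maximal: "\<And>B D. B \<in> V' \<Longrightarrow> D \<in> ?F \<Longrightarrow> pts B \<subseteq> pts D \<Longrightarrow> pts D = pts B"
      using Vitali_finite_maximal[of ?F] finite_subset[OF FT finT] by metis
    have V'T: "V' \<subseteq> ?T" using V'(1) FT by blast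
    have finV: "finite V" "finite V'"
      using finite_subset[OF _ finT] V(1) V'T by blast+
    have disjVV': "pts B \<inter> pts D = {}" if "B \<in> V" "D \<in> V'" for B D
      using disj[OF _ that(1)] V'(1) that(2) by blast
    define W'' where "W'' = {x \<in> W'. \<forall>B\<in>V'. pts (U i x) \<inter> pts B = {}}"
    have disj_fam: "disjoint_family_on pts (V \<union> V')"
      using V(2) V'(2) disjVV' by (auto simp: disjoint_family_on_def) blast+
    moreover have "\<forall>x\<in>W''. \<forall>B\<in>V \<union> V'. pts (U i x) \<inter> pts B = {}"
    proof (intro ballI)
      fix x B assume x: "x \<in> W''" and B: "B \<in> V \<union> V'"
      have "pts (U i x) \<subseteq> pts (U (Suc i) x)"
        using x W' i by (intro step_sub) (auto simp: W''_def)
      with x B disj[of x B] show "pts (U i x) \<inter> pts B = {}"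
        by (auto simp: W''_def)
    qed
    moreover have "\<forall>x\<in>W - W''. \<exists>B\<in>V \<union> V'. pts (U 1 x) \<subseteq> pts (enlarge (4 / \<delta>) B)"
    proof
      fix x assume x: "x \<in> W - W''"
      show "\<exists>B\<in>V \<union> V'. pts (U 1 x) \<subseteq> pts (enlarge (4 / \<delta>) B)"
      proof (cases "x \<in> W'")
        case False
        then show ?thesis using cov[of x] x by blast
      next
        case True
        then obtain B where B: "B \<in> V'" "pts (U i x) \<inter> pts B \<noteq> {}"
          using x by (auto simp: W''_def)
        have "pts (U 1 x) \<subseteq> pts (enlarge (4 / \<delta>) B)"
        \<comment> \<open>If the expanded ball contains \<open>B\<close>, so does
          \<open>U (Suc i) x\<close>. Since \<open>x \<in> W'\<close>, that ball was itself a
          candidate in \<open>?F\<close>, and maximality of \<open>B\<close> forces equality of the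
          point sets.\<close>
        proof (cases "pts B \<subseteq> pts (enlarge \<delta> (U i x))")
          case True
          have "pts (enlarge \<delta> (U i x)) \<subseteq> pts (U (Suc i) x)"
            using expanding x i by (auto simp: expanding_def)
          then have "pts (U (Suc i) x) = pts B"
            using maximal[OF B(1)] True \<open>x \<in> W'\<close> by blast
          then have "pts (U 1 x) \<subseteq> pts B"
            using bottom[of x "Suc i"] x i by auto
          also have "pts B \<subseteq> pts (enlarge (4 / \<delta>) B)"
          proof -
            have "radius B \<ge> 0" using radius_F B(1) V'(1) by blast
            then have "1 * radius B \<le> (1 + 4 / \<delta>) * radius B"
              using \<open>0 < \<delta>\<close> by (intro mult_right_mono) auto
            then show ?thesis
              by (auto simp: pts_def enlarge_def)
          qed
          finally show ?thesis .
        next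
          case False
          then have "pts (U i x) \<subseteq> pts (enlarge (4 / \<delta>) B)"
            using pts_subset_enlarge[OF B(2) \<open>0 < \<delta>\<close>] by blast
          then show ?thesis using bottom[of x i] x i by auto
        qed
        then show ?thesis using B(1) by blast
      qed
    qed
    moreover have "measure \<mu> A - M * ?v (V \<union> V') \<le> (1 - 1 / L) ^ Suc k * measure \<mu> A"
    proof -
      \<comment> \<open>The first-level ball of a point of \<open>W'\<close> lies in its candidate
        ball, hence in the tripled balls of \<open>V'\<close>; the remaining points were covered
        earlier by \<open>V\<close>. Taking measures bounds the old deficit by \<open>L\<close>
        times the mass of \<open>V'\<close>.\<close>
      have "A \<subseteq> (\<Union>B\<in>V. pts (enlarge (4 / \<delta>) B)) \<union> (\<Union>B\<in>V'. pts (enlarge 2 B))"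
      proof
        fix y assume "y \<in> A"
        then obtain x where x: "x \<in> W" "y \<in> pts (U 1 x)"
          by (auto simp: A_def tower_level_def)
        show "y \<in> (\<Union>B\<in>V. pts (enlarge (4 / \<delta>) B)) \<union> (\<Union>B\<in>V'. pts (enlarge 2 B))"
        proof (cases "x \<in> W'")
          case True
          then have "y \<in> (\<Union>B\<in>?F. pts B)"
            using bottom[of x "Suc i"] x i by auto
          then show ?thesis using V'(3) by blast
        next
          case False
          then show ?thesis using cov[of x] x by blast
        qed
      qed
      moreover have "A \<in> sets \<mu>"
        unfolding A_def using inT \<open>1 \<le> n\<close>
        by (intro fmeasurableD fmU) (auto simp: tower_level_def)
      ultimately have "measure \<mu> A \<le>
          measure \<mu> ((\<Union>B\<in>V. pts (enlarge (4 / \<delta>) B)) \<union> (\<Union>B\<in>V'. pts (enlarge 2 B)))"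
        using finV fm by (intro measure_mono_fmeasurable fmeasurable.Un fmeasurable.finite_UN) auto
      also have "\<dots> \<le> measure \<mu> (\<Union>B\<in>V. pts (enlarge (4 / \<delta>) B)) +
          measure \<mu> (\<Union>B\<in>V'. pts (enlarge 2 B))"
        using finV fm by (intro measure_Un_le fmeasurableD fmeasurable.finite_UN) auto
      also have "\<dots> \<le> M * ?v V + L * ?v V'"
        using V V' V'T finV fm L M by (intro add_mono measure_UN_enlarge_le) auto
      finally have gain: "(measure \<mu> A - M * ?v V) / L \<le> ?v V'"
        using \<open>1 \<le> L\<close> by (simp add: field_simps)
      have "?v (V \<union> V') = ?v V + ?v V'"
        unfolding UN_Un using disjVV' fmU[OF V(1)] fmU[OF V'T]
        by (intro measure_Un3[THEN trans]) (auto simp: Int_UN_distrib2)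
      moreover have "?v V' \<le> M * ?v V'"
        using \<open>1 \<le> M\<close> by (simp add: mult_le_cancel_right1)
      \<comment> \<open>With d the old deficit and v the measure of the new balls:
        \<open>d - M * v \<le> d - v \<le> d - d / L\<close>.\<close>
      ultimately have "measure \<mu> A - M * ?v (V \<union> V') \<le>
          (1 - 1 / L) * (measure \<mu> A - M * ?v V)"
        using gain by (simp add: algebra_simps diff_divide_distrib)
      also have "\<dots> \<le> (1 - 1 / L) * ((1 - 1 / L) ^ k * measure \<mu> A)"
        using le \<open>1 \<le> L\<close> by (intro mult_left_mono) auto
      finally show ?thesis by (simp add: mult.assoc)
    qed
    moreover have "V \<union> V' \<subseteq> ?T" "W'' \<subseteq> W"
      using V(1) V'T W' by (auto simp: W''_def)
    ultimately show ?case
      unfolding i_def[symmetric] by blast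
  qed
  show ?thesis
    using claim[of "n - 1"] \<open>1 \<le> n\<close> by (auto simp: less_eq_Suc_le)
qed

section \<open>Uniform volume growth over bounded sets of centers\<close>

text \<open>The growth limit is only pointwise in the center. Uniformity comes from comparing with
  one center \<open>x0\<close>: a ball around \<open>x\<close> is squeezed between balls around
  \<open>x0\<close> whose radii differ from its own by \<open>R\<close>, and a bounded change of
  radius does not affect the asymptotics.\<close>

lemma uniform_ball_growth:
  fixes \<mu> :: "'a::metric_space measure" and q K :: real and X0 :: "'a set"
  assumes "exact_polynomial_growth \<mu> q" and "bounded X0" and "1 < K"
  shows "\<exists>s>0. \<forall>x\<in>X0. \<forall>r\<ge>s. \<forall>t\<ge>1.
    measure \<mu> (cball x (t * r)) \<le> K * t powr q * measure \<mu> (cball x r)"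
proof -
  obtain c where "c > 0"
    and lim: "\<And>x. ((\<lambda>t. measure \<mu> (cball x t) / (c * t powr q)) \<longlongrightarrow> 1) at_top"
    using assms(1) by (auto simp: exact_polynomial_growth_def)
  have borel: "sets \<mu> = sets borel" and pos: "strictly_positive \<mu>"
    using assms(1) by (auto simp: exact_polynomial_growth_def borel_measure_def)
  have fm: "cball x r \<in> fmeasurable \<mu>" if "r > 0" for x r
    using pos that by (intro fmeasurableI) (auto simp: borel strictly_positive_def)
  obtain x0 R where R: "X0 \<subseteq> cball x0 R"
    using assms(2) by (metis bounded_def mem_cball subsetI)
  \<comment> \<open>The error factor is spent twice, once on the larger ball from above and once on
    the smaller ball from below, so each gets a square root of \<open>K\<close>.\<close>
  define u where "u = sqrt K"
  have u: "1 < u" "u * u = K" using assms(3) by (auto simp: u_def)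
  \<comment> \<open>The radius is shifted but the normalization is not: the discrepancy
    \<open>(1 + a / t) powr q\<close> tends to 1.\<close>
  have shift: "((\<lambda>t. measure \<mu> (cball x0 (t + a)) / (c * t powr q)) \<longlongrightarrow> 1) at_top" for a
  proof -
    have "filterlim (\<lambda>t::real. t + a) at_top at_top"
      using filterlim_tendsto_add_at_top[OF tendsto_const filterlim_ident, of a] by (simp add: add.commute)
    then have 1: "((\<lambda>t. measure \<mu> (cball x0 (t + a)) / (c * (t + a) powr q)) \<longlongrightarrow> 1) at_top"
      by (rule filterlim_compose[OF lim])
    have "((\<lambda>t::real. 1 + a / t) \<longlongrightarrow> 1 + 0) at_top"
      by (intro tendsto_intros tendsto_divide_0[OF tendsto_const] filterlim_at_top_imp_at_infinity filterlim_ident)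
    then have "((\<lambda>t::real. (1 + a / t) powr q) \<longlongrightarrow> (1 + 0) powr q) at_top"
      by (intro tendsto_powr) auto
    then have "((\<lambda>t. measure \<mu> (cball x0 (t + a)) / (c * (t + a) powr q) * (1 + a / t) powr q)
        \<longlongrightarrow> 1) at_top"
      using tendsto_mult[OF 1] by fastforce
    moreover have "\<forall>\<^sub>F t in at_top. measure \<mu> (cball x0 (t + a)) / (c * (t + a) powr q) *
        (1 + a / t) powr q = measure \<mu> (cball x0 (t + a)) / (c * t powr q)"
      using eventually_gt_at_top[of "\<bar>a\<bar>"]
    proof eventually_elim
      case (elim t)
      then have "1 + a / t = (t + a) / t" by (simp add: field_simps)
      then show ?case using elim by (simp add: powr_divide field_simps)
    qed
    ultimately show ?thesis
      by (rule Lim_transform_eventually)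
  qed
  have "\<forall>\<^sub>F t in at_top. measure \<mu> (cball x0 (t + R)) / (c * t powr q) < u"
    using order_tendstoD(2)[OF shift] u by blast
  moreover have "\<forall>\<^sub>F t in at_top. 1 / u < measure \<mu> (cball x0 (t + - R)) / (c * t powr q)"
    using u(1) by (intro order_tendstoD(1)[OF shift]) simp
  \<comment> \<open>The clause \<open>t > \<bar>R\<bar>\<close> keeps the shifted radii positive,
    where finiteness of the measure is known, and makes the threshold \<open>s\<close>
    positive.\<close>
  ultimately have "\<forall>\<^sub>F t in at_top. measure \<mu> (cball x0 (t + R)) \<le> u * (c * t powr q) \<and>
      c * t powr q \<le> u * measure \<mu> (cball x0 (t - R)) \<and> t > \<bar>R\<bar>"
    using eventually_gt_at_top[of "\<bar>R\<bar>"]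
  proof eventually_elim
    case (elim t)
    then have "0 < c * t powr q" using \<open>c > 0\<close> by simp
    with elim u show ?case by (simp add: field_simps)
  qed
  then obtain s where s: "\<And>t. t \<ge> s \<Longrightarrow> measure \<mu> (cball x0 (t + R)) \<le> u * (c * t powr q) \<and>
      c * t powr q \<le> u * measure \<mu> (cball x0 (t - R)) \<and> t > \<bar>R\<bar>"
    by (auto simp: eventually_at_top_linorder)
  show ?thesis
  proof (intro exI[of _ s] conjI ballI allI impI)
    show "s > 0" using s[of s] by auto
    fix x and r t :: real assume x: "x \<in> X0" and r: "s \<le> r" and t: "1 \<le> t"
    have "0 < r" using r \<open>s > 0\<close> by simp
    then have "r \<le> t * r" using t by simp
    then have tr: "s \<le> t * r" using r by simp
    have xR: "dist x0 x \<le> R" using R x by auto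
    have "measure \<mu> (cball x (t * r)) \<le> measure \<mu> (cball x0 (t * r + R))"
    proof (intro measure_mono_fmeasurable)
      show "cball x (t * r) \<subseteq> cball x0 (t * r + R)"
      proof
        fix y assume "y \<in> cball x (t * r)"
        then show "y \<in> cball x0 (t * r + R)" using xR dist_triangle[of x0 y x] by simp
      qed
    qed (use s[OF tr] in \<open>auto simp: borel intro!: fm\<close>)
    also have "\<dots> \<le> u * (c * (t * r) powr q)"
      using s[OF tr] by blast
    also have "\<dots> = u * t powr q * (c * r powr q)"
      using \<open>0 < r\<close> t by (simp add: powr_mult)
    also have "\<dots> \<le> u * t powr q * (u * measure \<mu> (cball x0 (r - R)))"
      using s[OF r] u by (intro mult_left_mono) auto
    also have "\<dots> = K * t powr q * measure \<mu> (cball x0 (r - R))"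
      using u by (simp add: algebra_simps)
    also have "measure \<mu> (cball x0 (r - R)) \<le> measure \<mu> (cball x r)"
    proof (intro measure_mono_fmeasurable)
      show "cball x0 (r - R) \<subseteq> cball x r"
      proof
        fix y assume "y \<in> cball x0 (r - R)"
        then show "y \<in> cball x r" using xR dist_triangle[of x y x0] by (simp add: dist_commute)
      qed
    qed (use \<open>0 < r\<close> in \<open>auto simp: borel intro!: fm\<close>)
    finally show "measure \<mu> (cball x (t * r)) \<le> K * t powr q * measure \<mu> (cball x r)"
      using assms(3) by (simp add: mult_left_mono)
  qed
qed

section \<open>Choice of constants and conclusion\<close>

theorem theorem3p5:
  fixes \<mu> :: "'a::metric_space measure" and q C :: real and X0 :: "'a set"
  assumes "exact_polynomial_growth \<mu> q"
    and "q > 0"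
    and "bounded X0"
    and "C = 3 powr (q + 1) / (3 powr (q + 1) - 1)"
  shows "\<exists>\<epsilon>0. 0 < \<epsilon>0 \<and> \<epsilon>0 < 1 \<and>
    (\<forall>\<epsilon>. 0 < \<epsilon> \<and> \<epsilon> < \<epsilon>0 \<longrightarrow>
      (\<exists>s0 :: real. \<forall>W n U.
        tower W n U \<and>
        expanding (1 + 36 * q / \<epsilon>) W n U \<and>
        core (tower_balls W n U) \<subseteq> X0 \<and>
        rad (tower_balls W n U) \<ge> s0 \<and>
        real n \<ge> 1 + log C (2 / \<epsilon>) \<longrightarrow>
        (\<exists>V \<subseteq> tower_balls W n U.
          disjoint_family_on pts V \<and>
          emeasure \<mu> (\<Union>B\<in>V. pts B)
            \<ge> ennreal (1 - \<epsilon>) * emeasure \<mu> (\<Union>B\<in>tower_level W U 1. pts B))))"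
proof -
  have borel: "sets \<mu> = sets borel" and pos: "strictly_positive \<mu>"
    using assms(1) by (auto simp: exact_polynomial_growth_def borel_measure_def)
  have fin: "cball x r \<in> fmeasurable \<mu>" for x :: 'a and r
  proof -
    \<comment> \<open>Strict positivity speaks only of positive radii; other balls are measurable
      subsets of such a ball.\<close>
    have "cball x (max r 1) \<in> fmeasurable \<mu>"
      using pos by (intro fmeasurableI) (auto simp: borel strictly_positive_def)
    then show ?thesis
      by (rule fmeasurableI2) (auto simp: borel)
  qed
  define L where "L = 3 powr (q + 1)"
  have L: "1 < L" "C = L / (L - 1)"
    using assms(2,4) by (auto simp: L_def)
  have C: "1 < C" using L(1) unfolding L(2) by (simp add: less_divide_eq)
  show ?thesis
  \<comment> \<open>The value 1/2 is a convenient choice; the estimates below work for every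
    \<epsilon> in (0,1).\<close>
  proof (rule exI[of _ "1/2"], intro conjI allI impI)
    fix \<epsilon> :: real assume "0 < \<epsilon> \<and> \<epsilon> < 1 / 2"
    then have \<epsilon>: "0 < \<epsilon>" "\<epsilon> < 1 / 2" by auto
    \<comment> \<open>The allowance \<open>1 + \<epsilon> / 2\<close> is split between two losses:
      \<open>exp (\<epsilon> / 9)\<close> pays for enlarging balls by \<open>4 / \<delta>\<close>,
      and \<open>K\<close> for the deviation from exact growth.\<close>
    define K where "K = (1 + \<epsilon> / 2) / exp (\<epsilon> / 9)"
    have "exp (\<epsilon> / 9) \<le> 1 + \<epsilon> / 9 + (\<epsilon> / 9)\<^sup>2"
      using \<epsilon> by (intro exp_bound) auto
    also have "\<dots> < 1 + \<epsilon> / 2"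
    proof -
      have "(\<epsilon> / 9)\<^sup>2 \<le> \<epsilon> / 9" using \<epsilon> by (simp add: power2_eq_square)
      then show ?thesis using \<epsilon> by linarith
    qed
    finally have K1: "1 < K" by (simp add: K_def)
    have "1 + \<epsilon> / 2 \<le> 3 * exp (\<epsilon> / 9)"
      using \<epsilon> exp_ge_add_one_self[of "\<epsilon> / 9"] by linarith
    then have K3: "K \<le> 3" by (simp add: K_def divide_le_eq)
    define \<delta> where "\<delta> = 1 + 36 * q / \<epsilon>"
    have \<delta>: "0 < \<delta>" using \<epsilon> assms(2) by (simp add: \<delta>_def add_pos_pos)
    \<comment> \<open>Here the constant 36 is used:
      \<open>\<delta> \<ge> 36 * q / \<epsilon>\<close> gives
      \<open>4 * q / \<delta> \<le> \<epsilon> / 9\<close>.\<close>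
    have "(1 + 4 / \<delta>) powr q \<le> exp (4 / \<delta>) powr q"
      using \<delta> assms(2) by (intro powr_mono2) auto
    also have "\<dots> \<le> exp (\<epsilon> / 9)"
      using \<epsilon> assms(2) \<delta> by (simp add: exp_powr_real \<delta>_def field_simps)
    finally have "K * (1 + 4 / \<delta>) powr q \<le> K * exp (\<epsilon> / 9)"
      using K1 by (intro mult_left_mono) auto
    then have KM: "K * (1 + 4 / \<delta>) powr q \<le> 1 + \<epsilon> / 2"
      by (simp add: K_def)
    \<comment> \<open>Tripling radii costs \<open>3 powr q\<close>; the additional factor 3 in
      \<open>L\<close> absorbs \<open>K\<close>.\<close>
    have KL: "K * 3 powr q \<le> L"
      using K3 by (simp add: L_def powr_add)
    obtain s where s: "0 < s" and growth: "\<And>x r t. x \<in> X0 \<Longrightarrow> s \<le> r \<Longrightarrow> 1 \<le> t \<Longrightarrow>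
        measure \<mu> (cball x (t * r)) \<le> K * t powr q * measure \<mu> (cball x r)"
      using uniform_ball_growth[OF assms(1,3) K1] by blast
    show "\<exists>s0 :: real. \<forall>W n U.
        tower W n U \<and>
        expanding (1 + 36 * q / \<epsilon>) W n U \<and>
        core (tower_balls W n U) \<subseteq> X0 \<and>
        rad (tower_balls W n U) \<ge> s0 \<and>
        real n \<ge> 1 + log C (2 / \<epsilon>) \<longrightarrow>
        (\<exists>V \<subseteq> tower_balls W n U.
          disjoint_family_on pts V \<and>
          emeasure \<mu> (\<Union>B\<in>V. pts B)
            \<ge> ennreal (1 - \<epsilon>) * emeasure \<mu> (\<Union>B\<in>tower_level W U 1. pts B))"
    proof (rule exI[of _ s], intro allI impI, elim conjE)
      fix W n and U :: "nat \<Rightarrow> 'a \<Rightarrow> 'a marked_ball"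
      let ?T = "tower_balls W n U"
      let ?A = "\<Union>B\<in>tower_level W U 1. pts B"
      assume tower: "tower W n U" and exp: "expanding (1 + 36 * q / \<epsilon>) W n U"
        and core: "core ?T \<subseteq> X0" and rad: "s \<le> rad ?T"
        and n: "1 + log C (2 / \<epsilon>) \<le> real n"
      have finT: "finite ?T" using tower by (simp add: tower_def)
      \<comment> \<open>This rules out height 0, for which level 1 would not belong to the tower and
        \<open>n - 1\<close> would truncate.\<close>
      have "0 < log C (2 / \<epsilon>)" using C \<epsilon> by simp
      then have n1: "1 \<le> n" using n by linarith
      have enl: "measure \<mu> (pts (enlarge \<gamma> B)) \<le> K * (1 + \<gamma>) powr q * measure \<mu> (pts B)"
        if "B \<in> ?T" "0 \<le> \<gamma>" for \<gamma> B
      proof -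
        have "s \<le> radius B"
          using rad that(1) finT unfolding rad_def
          by (meson cInf_lower bdd_below_finite finite_imageI imageI order_trans)
        moreover have "center B \<in> X0" using core that(1) by (auto simp: core_def)
        ultimately show ?thesis
          using growth[of "center B" "radius B" "1 + \<gamma>"] that(2) by (simp add: pts_def enlarge_def)
      qed
      have eL: "measure \<mu> (pts (enlarge 2 B)) \<le> L * measure \<mu> (pts B)" if "B \<in> ?T" for B
        using enl[OF that, of 2] mult_right_mono[OF KL, of "measure \<mu> (pts B)"] by simp
      have eM: "measure \<mu> (pts (enlarge (4 / \<delta>) B)) \<le> (1 + \<epsilon> / 2) * measure \<mu> (pts B)"
        if "B \<in> ?T" for B
        using enl[OF that, of "4 / \<delta>"] mult_right_mono[OF KM, of "measure \<mu> (pts B)"] \<delta> by simp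
      have "\<exists>V\<subseteq>?T. disjoint_family_on pts V \<and>
          measure \<mu> ?A - (1 + \<epsilon> / 2) * measure \<mu> (\<Union>B\<in>V. pts B)
            \<le> (1 - 1 / L) ^ (n - 1) * measure \<mu> ?A"
        using L(1) \<epsilon>(1)
        by (intro tower_selection[OF tower exp[folded \<delta>_def] \<delta> fin eL eM _ _ n1]) simp_all
      then obtain V where V: "V \<subseteq> ?T" "disjoint_family_on pts V"
        and le: "measure \<mu> ?A - (1 + \<epsilon> / 2) * measure \<mu> (\<Union>B\<in>V. pts B)
          \<le> (1 - 1 / L) ^ (n - 1) * measure \<mu> ?A"
        by blast
      \<comment> \<open>The per-level factor is exactly \<open>1 / C\<close>, so the height
        condition pushes the remaining deficit below \<epsilon>/2 times the measure of the first
        level.\<close>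
      have "1 - 1 / L = inverse C" using L(1) unfolding L(2) by (simp add: diff_divide_distrib)
      then have "(1 - 1 / L) ^ (n - 1) = inverse (C ^ (n - 1))"
        by (simp add: power_inverse)
      also have "\<dots> \<le> \<epsilon> / 2"
      proof -
        have "2 / \<epsilon> = C powr (log C (2 / \<epsilon>))" using C \<epsilon> by simp
        also have "\<dots> \<le> C powr real (n - 1)"
          using C n n1 by (intro powr_mono) (auto simp: of_nat_diff)
        also have "\<dots> = C ^ (n - 1)" using C by (simp add: powr_realpow)
        finally show ?thesis using le_imp_inverse_le[of "2 / \<epsilon>" "C ^ (n - 1)"] \<epsilon> by simp
      qed
      finally have "(1 - 1 / L) ^ (n - 1) * measure \<mu> ?A \<le> \<epsilon> / 2 * measure \<mu> ?A"
        by (intro mult_right_mono) auto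
      with le have le': "(1 - \<epsilon> / 2) * measure \<mu> ?A \<le> (1 + \<epsilon> / 2) * measure \<mu> (\<Union>B\<in>V. pts B)"
        by (simp add: algebra_simps)
      \<comment> \<open>The product of \<open>1 + \<epsilon> / 2\<close> and
        \<open>1 - \<epsilon>\<close> is \<open>1 - \<epsilon> / 2 - \<epsilon>\<^sup>2 / 2\<close>,
        so the common factor \<open>1 + \<epsilon> / 2\<close> can be cancelled afterwards.\<close>
      have "(1 + \<epsilon> / 2) * ((1 - \<epsilon>) * measure \<mu> ?A) \<le> (1 - \<epsilon> / 2) * measure \<mu> ?A"
        unfolding mult.assoc[symmetric] using \<epsilon> by (intro mult_right_mono) (auto simp: algebra_simps)
      also note le'
      finally have main: "(1 - \<epsilon>) * measure \<mu> ?A \<le> measure \<mu> (\<Union>B\<in>V. pts B)"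
        using \<epsilon> by simp
      have fmU: "(\<Union>B\<in>G. pts B) \<in> fmeasurable \<mu>" if "G \<subseteq> ?T" for G
        using finite_subset[OF that finT] fin by (intro fmeasurable.finite_UN) (auto simp: pts_def)
      have "tower_level W U 1 \<subseteq> ?T"
        using n1 by (auto simp: tower_balls_def)
      then have "ennreal (1 - \<epsilon>) * emeasure \<mu> ?A = ennreal ((1 - \<epsilon>) * measure \<mu> ?A)"
        using \<epsilon> by (simp add: emeasure_eq_measure2 fmU ennreal_mult)
      also have "\<dots> \<le> emeasure \<mu> (\<Union>B\<in>V. pts B)"
        using main by (simp add: emeasure_eq_measure2 fmU[OF V(1)] ennreal_leI)
      finally show "\<exists>V\<subseteq>?T. disjoint_family_on pts V \<and>
          emeasure \<mu> (\<Union>B\<in>V. pts B) \<ge> ennreal (1 - \<epsilon>) * emeasure \<mu> ?A"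
        using V by blast
    qed
  qed auto
qed

end
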